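(* Let $G=N\rtimes Q$ be a group which is the internal semidirect product of a normal subgroup $N$ by a subgroup $Q$, and let $H=M\rtimes R$, where $M$ is a normal subgroup of $N$ and $R$ is a subgroup of $Q$ which normalizes $M$. If $(G,H)$ is a reduced Hecke pair with Schlichting completion $(\bar G,\bar H)$, then $$\bar G=\bar N\rtimes\bar Q\quad\text{and}\quad\bar H=\bar M\rtimes\bar R,$$ where the closures are all taken in $\bar G$.
   Context: A Hecke pair $(G,H)$ is a group $G$ with a subgroup $H$ such that every double coset $HxH$ is a finite union of left cosets; it is reduced if $\bigcap_{x\in G}xHx^{-1}=\{e\}$. A Schlichting pair is a reduced Hecke pair with $G$ locally compact Hausdorff and $H$ compact open in $G$. The Hecke topology on $G$ is the group topology for which $\{xHx^{-1}\mid x\in G\}$ is a local subbase of neighborhoods of $e$. The Schlichting completion of a reduced Hecke pair $(G,H)$ is the pair $(\bar G,\bar H)$, where $\bar G$ is the completion of $G$ in the two-sided uniformity of the Hecke topology and $\bar H$ is the closure of $H$ in $\bar G$; it is a Schlichting pair, and $G$ embeds densely in $\bar G$ with $H=G\cap\bar H$. For a topological group $K$ with subgroups $L,S$, $K=L\rtimes S$ means: $L$ is normal in $K$, $LS=K$, $L\cap S=\{e\}$, and $K$ has the product topology of $L\times S$. *)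

theory Defs
  imports "HOL-Analysis.Analysis" "HOL-Algebra.Coset"
begin

section \<open>Topological groups\<close>

locale topological_group = group K for K (structure) +
  fixes T :: "'a topology"
  assumes topspace_eq: "topspace T = carrier K"
    and continuous_mult: "continuous_map (prod_topology T T) T (\<lambda>(x, y). x \<otimes> y)"
    and continuous_inv: "continuous_map T T (\<lambda>x. inv x)"

text \<open>Uniformities are represented by the filter of their entourages, as in the library's class of
  uniform spaces, but on the carrier: every entourage filter lies below
  the principal filter of \<open>carrier K \<times> carrier K\<close>.\<close>

definition two_sided_uniformity ::
    "('a, 'c) monoid_scheme \<Rightarrow> 'a topology \<Rightarrow> ('a \<times> 'a) filter" where
  "two_sided_uniformity K T =
     (INF U\<in>{U. openin T U \<and> \<one>\<^bsub>K\<^esub> \<in> U}.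
        principal {(x, y). x \<in> carrier K \<and> y \<in> carrier K \<and>
          inv\<^bsub>K\<^esub> x \<otimes>\<^bsub>K\<^esub> y \<in> U \<and> y \<otimes>\<^bsub>K\<^esub> inv\<^bsub>K\<^esub> x \<in> U})"

definition two_sided_complete :: "('a, 'c) monoid_scheme \<Rightarrow> 'a topology \<Rightarrow> bool" where
  "two_sided_complete K T \<longleftrightarrow>
     (\<forall>F. F \<noteq> bot \<and> F \<le> principal (carrier K) \<and> F \<times>\<^sub>F F \<le> two_sided_uniformity K T \<longrightarrow>
        (\<exists>x\<in>carrier K. F \<le> nhdsin T x))"

text \<open>\<open>K\<close> with topology \<open>TK\<close> is, via \<open>\<iota>\<close>, a (Hausdorff) completion of the topological group \<open>G\<close>
  with topology \<open>T\<close> in its two-sided uniformity. The equation of filters says that \<open>\<iota>\<close> is an embedding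
  of uniform spaces: the uniformity of \<open>G\<close> is the one induced from \<open>K\<close>. The group operations of \<open>K\<close>,
  being continuous, are the unique continuous extensions of those of \<open>G\<close>.\<close>

definition group_completion ::
    "('a, 'c) monoid_scheme \<Rightarrow> 'a topology \<Rightarrow> ('b, 'd) monoid_scheme \<Rightarrow> 'b topology \<Rightarrow> ('a \<Rightarrow> 'b) \<Rightarrow> bool"
  where
  "group_completion G T K TK \<iota> \<longleftrightarrow>
     topological_group G T \<and> topological_group K TK \<and>
     Hausdorff_space TK \<and> two_sided_complete K TK \<and>
     \<iota> \<in> hom G K \<and> inj_on \<iota> (carrier G) \<and>
     two_sided_uniformity G T =
       inf (principal (carrier G \<times> carrier G))
           (filtercomap (map_prod \<iota> \<iota>) (two_sided_uniformity K TK)) \<and>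
     TK closure_of (\<iota> ` carrier G) = carrier K"


section \<open>Hecke pairs and the Hecke topology\<close>

definition Hecke_pair :: "('a, 'c) monoid_scheme \<Rightarrow> 'a set \<Rightarrow> bool" where
  "Hecke_pair G H \<longleftrightarrow> group G \<and> subgroup H G \<and>
     (\<forall>x\<in>carrier G. \<exists>F. finite F \<and> F \<subseteq> carrier G \<and>
        H <#>\<^bsub>G\<^esub> (x <#\<^bsub>G\<^esub> H) = (\<Union>g\<in>F. g <#\<^bsub>G\<^esub> H))"

abbreviation conj_set :: "('a, 'c) monoid_scheme \<Rightarrow> 'a \<Rightarrow> 'a set \<Rightarrow> 'a set" where
  "conj_set G x H \<equiv> x <#\<^bsub>G\<^esub> H #>\<^bsub>G\<^esub> inv\<^bsub>G\<^esub> x"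

definition reduced_Hecke_pair :: "('a, 'c) monoid_scheme \<Rightarrow> 'a set \<Rightarrow> bool" where
  "reduced_Hecke_pair G H \<longleftrightarrow> Hecke_pair G H \<and>
     (\<Inter>x\<in>carrier G. conj_set G x H) = {\<one>\<^bsub>G\<^esub>}"

text \<open>Finite intersections of conjugates; the carrier takes care of the empty intersection.\<close>

definition Hecke_nbhd :: "('a, 'c) monoid_scheme \<Rightarrow> 'a set \<Rightarrow> 'a set \<Rightarrow> 'a set" where
  "Hecke_nbhd G H F = carrier G \<inter> (\<Inter>x\<in>F. conj_set G x H)"

definition Hecke_topology :: "('a, 'c) monoid_scheme \<Rightarrow> 'a set \<Rightarrow> 'a topology" where
  "Hecke_topology G H = topology (\<lambda>U. U \<subseteq> carrier G \<and>
     (\<forall>g\<in>U. \<exists>F. finite F \<and> F \<subseteq> carrier G \<and> g <#\<^bsub>G\<^esub> Hecke_nbhd G H F \<subseteq> U))"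

text \<open>The following lemmas justify the definition: \<open>Hecke_topology G H\<close> is a group topology, and the
  conjugates of \<open>H\<close> are a local subbase of neighbourhoods of the identity. Two group topologies
  with the same neighbourhoods of the identity agree, so these properties determine it.\<close>

lemma openin_Hecke_topology:
  "openin (Hecke_topology G H) U \<longleftrightarrow> U \<subseteq> carrier G \<and>
     (\<forall>g\<in>U. \<exists>F. finite F \<and> F \<subseteq> carrier G \<and> g <#\<^bsub>G\<^esub> Hecke_nbhd G H F \<subseteq> U)"
proof -
  let ?P = "\<lambda>U. U \<subseteq> carrier G \<and>
     (\<forall>g\<in>U. \<exists>F. finite F \<and> F \<subseteq> carrier G \<and> g <#\<^bsub>G\<^esub> Hecke_nbhd G H F \<subseteq> U)"
  have "istopology ?P"
    unfolding istopology_def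
  proof (intro conjI allI impI)
    fix S S' assume S: "?P S" and S': "?P S'"
    show "S \<inter> S' \<subseteq> carrier G" using S by blast
    show "\<forall>g\<in>S \<inter> S'. \<exists>F. finite F \<and> F \<subseteq> carrier G \<and> g <#\<^bsub>G\<^esub> Hecke_nbhd G H F \<subseteq> S \<inter> S'"
    proof
      fix g assume "g \<in> S \<inter> S'"
      then obtain F F' where F: "finite F" "F \<subseteq> carrier G" "g <#\<^bsub>G\<^esub> Hecke_nbhd G H F \<subseteq> S"
        and F': "finite F'" "F' \<subseteq> carrier G" "g <#\<^bsub>G\<^esub> Hecke_nbhd G H F' \<subseteq> S'"
        using S S' by (metis IntD1 IntD2)
      have "Hecke_nbhd G H (F \<union> F') = Hecke_nbhd G H F \<inter> Hecke_nbhd G H F'"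
        unfolding Hecke_nbhd_def by blast
      then have "g <#\<^bsub>G\<^esub> Hecke_nbhd G H (F \<union> F') \<subseteq> S \<inter> S'"
        using F(3) F'(3) unfolding l_coset_def by auto
      then show "\<exists>F. finite F \<and> F \<subseteq> carrier G \<and> g <#\<^bsub>G\<^esub> Hecke_nbhd G H F \<subseteq> S \<inter> S'"
        using F F' by (meson Un_least finite_UnI)
    qed
  next
    fix \<K> assume "\<forall>K\<in>\<K>. ?P K"
    then show "\<Union>\<K> \<subseteq> carrier G"
      and "\<forall>g\<in>\<Union>\<K>. \<exists>F. finite F \<and> F \<subseteq> carrier G \<and> g <#\<^bsub>G\<^esub> Hecke_nbhd G H F \<subseteq> \<Union>\<K>"
      by (blast, meson Union_iff Union_upper subset_trans)
  qed
  then show ?thesis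
    unfolding Hecke_topology_def by (simp add: topology_inverse')
qed

context group
begin

lemma mem_conj_set_iff:
  assumes "subgroup H G" "x \<in> carrier G" "y \<in> carrier G"
  shows "y \<in> conj_set G x H \<longleftrightarrow> inv x \<otimes> y \<otimes> x \<in> H"
proof
  assume "y \<in> conj_set G x H"
  then obtain h where h: "h \<in> H" "y = x \<otimes> h \<otimes> inv x"
    by (auto simp: l_coset_def r_coset_def)
  moreover have hc: "h \<in> carrier G" using h(1) assms(1) by (rule_tac subgroup.mem_carrier)
  have "inv x \<otimes> (x \<otimes> h \<otimes> inv x) \<otimes> x = (inv x \<otimes> x) \<otimes> h \<otimes> (inv x \<otimes> x)"
    using assms(2) hc by (simp only: m_assoc inv_closed m_closed)
  ultimately have "inv x \<otimes> y \<otimes> x = h" using assms(2) hc by simp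
  with h show "inv x \<otimes> y \<otimes> x \<in> H" by simp
next
  assume h: "inv x \<otimes> y \<otimes> x \<in> H"
  have "x \<otimes> (inv x \<otimes> y \<otimes> x) \<otimes> inv x = (x \<otimes> inv x) \<otimes> y \<otimes> (x \<otimes> inv x)"
    using assms(2,3) by (simp only: m_assoc inv_closed m_closed)
  then have "y = x \<otimes> (inv x \<otimes> y \<otimes> x) \<otimes> inv x" using assms(2,3) by simp
  with h show "y \<in> conj_set G x H"
    by (auto simp: l_coset_def r_coset_def)
qed

lemma mem_Hecke_nbhd_iff:
  assumes "subgroup H G" "F \<subseteq> carrier G"
  shows "y \<in> Hecke_nbhd G H F \<longleftrightarrow> y \<in> carrier G \<and> (\<forall>x\<in>F. inv x \<otimes> y \<otimes> x \<in> H)"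
  using assms unfolding Hecke_nbhd_def by (auto simp: mem_conj_set_iff subsetD)

lemma subgroup_Hecke_nbhd:
  assumes H: "subgroup H G" and F: "F \<subseteq> carrier G"
  shows "subgroup (Hecke_nbhd G H F) G"
proof (rule subgroupI)
  show "Hecke_nbhd G H F \<subseteq> carrier G" by (auto simp: Hecke_nbhd_def)
  have "\<one> \<in> Hecke_nbhd G H F"
    using F by (auto simp: mem_Hecke_nbhd_iff[OF H F] subgroup.one_closed[OF H] subsetD)
  then show "Hecke_nbhd G H F \<noteq> {}" by blast
next
  fix a assume a: "a \<in> Hecke_nbhd G H F"
  have "inv x \<otimes> inv a \<otimes> x \<in> H" if "x \<in> F" for x
  proof -
    have c: "a \<in> carrier G" "x \<in> carrier G" "inv x \<otimes> a \<otimes> x \<in> H"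
      using a F that by (auto simp: mem_Hecke_nbhd_iff[OF H F])
    then have "inv (inv x \<otimes> a \<otimes> x) = inv x \<otimes> inv a \<otimes> x"
      by (simp add: inv_mult_group m_assoc)
    then show ?thesis using subgroup.m_inv_closed[OF H c(3)] by simp
  qed
  then show "inv a \<in> Hecke_nbhd G H F"
    using a by (auto simp: mem_Hecke_nbhd_iff[OF H F])
next
  fix a b assume ab: "a \<in> Hecke_nbhd G H F" "b \<in> Hecke_nbhd G H F"
  have "inv x \<otimes> (a \<otimes> b) \<otimes> x \<in> H" if "x \<in> F" for x
  proof -
    have c: "a \<in> carrier G" "b \<in> carrier G" "x \<in> carrier G"
        "inv x \<otimes> a \<otimes> x \<in> H" "inv x \<otimes> b \<otimes> x \<in> H"
      using ab F that by (auto simp: mem_Hecke_nbhd_iff[OF H F])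
    have "(inv x \<otimes> a \<otimes> x) \<otimes> (inv x \<otimes> b \<otimes> x) = inv x \<otimes> (a \<otimes> (x \<otimes> inv x) \<otimes> b) \<otimes> x"
      using c(1-3) by (simp only: m_assoc inv_closed m_closed)
    also have "\<dots> = inv x \<otimes> (a \<otimes> b) \<otimes> x" using c(1-3) by simp
    finally show ?thesis using subgroup.m_closed[OF H c(4,5)] by simp
  qed
  then show "a \<otimes> b \<in> Hecke_nbhd G H F"
    using ab by (auto simp: mem_Hecke_nbhd_iff[OF H F])
qed

lemma mem_Hecke_nbhd_conj:
  assumes H: "subgroup H G" and F: "F \<subseteq> carrier G" and b: "b \<in> carrier G"
    and v: "v \<in> Hecke_nbhd G H ((\<lambda>x. b \<otimes> x) ` F)"
  shows "inv b \<otimes> v \<otimes> b \<in> Hecke_nbhd G H F"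
proof -
  have bF: "(\<lambda>x. b \<otimes> x) ` F \<subseteq> carrier G" using F b by auto
  have vc: "v \<in> carrier G" using v by (simp add: Hecke_nbhd_def)
  have "inv x \<otimes> (inv b \<otimes> v \<otimes> b) \<otimes> x \<in> H" if "x \<in> F" for x
  proof -
    have x: "x \<in> carrier G" using that F by auto
    have "inv (b \<otimes> x) \<otimes> v \<otimes> (b \<otimes> x) \<in> H"
      using v that by (auto simp: mem_Hecke_nbhd_iff[OF H bF])
    also have "inv (b \<otimes> x) \<otimes> v \<otimes> (b \<otimes> x) = inv x \<otimes> (inv b \<otimes> v \<otimes> b) \<otimes> x"
      using x b vc by (simp add: inv_mult_group m_assoc)
    finally show ?thesis .
  qed
  then show ?thesis using b vc by (auto simp: mem_Hecke_nbhd_iff[OF H F])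
qed

lemma openin_Hecke_coset:
  assumes H: "subgroup H G" and F: "finite F" "F \<subseteq> carrier G" and g: "g \<in> carrier G"
  shows "openin (Hecke_topology G H) (g <# Hecke_nbhd G H F)"
proof -
  let ?V = "Hecke_nbhd G H F"
  have V: "subgroup ?V G" using H F by (rule_tac subgroup_Hecke_nbhd)
  have "a <# ?V \<subseteq> g <# ?V" if "a \<in> g <# ?V" for a
    using l_repr_independence[OF that g V] by simp
  moreover have "g <# ?V \<subseteq> carrier G"
    using g V by (simp add: l_coset_subset_G subgroup.subset)
  ultimately show ?thesis
    unfolding openin_Hecke_topology using F by blast
qed

lemma mem_Hecke_coset:
  assumes "subgroup H G" "F \<subseteq> carrier G" "g \<in> carrier G"
  shows "g \<in> g <# Hecke_nbhd G H F"
proof -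
  have "\<one> \<in> Hecke_nbhd G H F"
    using subgroup_Hecke_nbhd[OF assms(1,2)] by (rule subgroup.one_closed)
  moreover have "g = g \<otimes> \<one>" using assms(3) by simp
  ultimately show ?thesis unfolding l_coset_def by blast
qed

lemma Hecke_local_subbase:
  assumes H: "subgroup H G"
  shows "x \<in> carrier G \<Longrightarrow> openin (Hecke_topology G H) (conj_set G x H) \<and> \<one> \<in> conj_set G x H"
    and "openin (Hecke_topology G H) U \<Longrightarrow> \<one> \<in> U \<Longrightarrow>
           \<exists>F. finite F \<and> F \<subseteq> carrier G \<and> carrier G \<inter> (\<Inter>x\<in>F. conj_set G x H) \<subseteq> U"
proof -
  assume x: "x \<in> carrier G"
  then have "x <# H \<subseteq> carrier G"
    using H by (simp add: l_coset_subset_G subgroup.subset)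
  then have "conj_set G x H \<subseteq> carrier G"
    using x by (simp add: r_coset_subset_G)
  then have eq: "\<one> <# Hecke_nbhd G H {x} = conj_set G x H"
    unfolding Hecke_nbhd_def by (auto simp: l_coset_def)
  show "openin (Hecke_topology G H) (conj_set G x H) \<and> \<one> \<in> conj_set G x H"
    using openin_Hecke_coset[OF H, of "{x}" \<one>] mem_Hecke_coset[OF H, of "{x}" \<one>] x eq by simp
next
  assume "openin (Hecke_topology G H) U" "\<one> \<in> U"
  then obtain F where F: "finite F" "F \<subseteq> carrier G" "\<one> <# Hecke_nbhd G H F \<subseteq> U"
    unfolding openin_Hecke_topology by blast
  have "\<one> <# Hecke_nbhd G H F = Hecke_nbhd G H F"
    by (auto simp: l_coset_def Hecke_nbhd_def)
  then show "\<exists>F. finite F \<and> F \<subseteq> carrier G \<and> carrier G \<inter> (\<Inter>x\<in>F. conj_set G x H) \<subseteq> U"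
    using F by (auto simp: Hecke_nbhd_def)
qed

lemma topological_group_Hecke_topology:
  assumes H: "subgroup H G"
  shows "topological_group G (Hecke_topology G H)"
proof -
  let ?T = "Hecke_topology G H" and ?V = "Hecke_nbhd G H"
  have "openin ?T (carrier G)"
    unfolding openin_Hecke_topology
    by (auto simp: l_coset_def Hecke_nbhd_def intro!: exI[of _ "{}"])
  then have top: "topspace ?T = carrier G"
    by (metis openin_Hecke_topology openin_subset openin_topspace subset_antisym)
  have mult: "continuous_map (prod_topology ?T ?T) ?T (\<lambda>(x, y). x \<otimes> y)"
    unfolding continuous_map_def
  proof (intro conjI allI impI)
    show "(\<lambda>(x, y). x \<otimes> y) \<in> topspace (prod_topology ?T ?T) \<rightarrow> topspace ?T"
      by (auto simp: top)
  next
    fix U assume U: "openin ?T U"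
    show "openin (prod_topology ?T ?T) {p \<in> topspace (prod_topology ?T ?T). (case p of (x, y) \<Rightarrow> x \<otimes> y) \<in> U}"
      unfolding openin_prod_topology_alt
    proof (intro allI impI)
      fix a b
      assume "(a, b) \<in> {p \<in> topspace (prod_topology ?T ?T). (case p of (x, y) \<Rightarrow> x \<otimes> y) \<in> U}"
      then have ab: "a \<in> carrier G" "b \<in> carrier G" "a \<otimes> b \<in> U" by (auto simp: top)
      obtain F where F: "finite F" "F \<subseteq> carrier G" "(a \<otimes> b) <# ?V F \<subseteq> U"
        using U ab(3) unfolding openin_Hecke_topology by blast
      define F' where "F' = (\<lambda>x. b \<otimes> x) ` F"
      have F': "finite F'" "F' \<subseteq> carrier G" using F ab by (auto simp: F'_def)
      have V: "subgroup (?V F) G" using H F by (rule_tac subgroup_Hecke_nbhd)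
      have "(a \<otimes> v) \<otimes> (b \<otimes> w) \<in> U" if v: "v \<in> ?V F'" and w: "w \<in> ?V F" for v w
      proof -
        have c: "v \<in> carrier G" "w \<in> carrier G" using v w by (auto simp: Hecke_nbhd_def)
        have "inv b \<otimes> v \<otimes> b \<in> ?V F"
          using mem_Hecke_nbhd_conj[OF H F(2) ab(2)] v by (simp add: F'_def)
        then have "(inv b \<otimes> v \<otimes> b) \<otimes> w \<in> ?V F" using w V by (simp add: subgroup.m_closed)
        then have "(a \<otimes> b) \<otimes> ((inv b \<otimes> v \<otimes> b) \<otimes> w) \<in> U"
          using F(3) by (auto simp: l_coset_def)
        moreover have "(a \<otimes> b) \<otimes> ((inv b \<otimes> v \<otimes> b) \<otimes> w) = a \<otimes> (b \<otimes> inv b) \<otimes> v \<otimes> b \<otimes> w"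
          using ab c by (simp only: m_assoc inv_closed m_closed)
        ultimately show ?thesis using ab c by (simp add: m_assoc)
      qed
      then have "(a <# ?V F') \<times> (b <# ?V F) \<subseteq>
          {p \<in> topspace (prod_topology ?T ?T). (case p of (x, y) \<Rightarrow> x \<otimes> y) \<in> U}"
        using ab by (auto simp: l_coset_def top Hecke_nbhd_def)
      then show "\<exists>A B. openin ?T A \<and> openin ?T B \<and> a \<in> A \<and> b \<in> B \<and> A \<times> B \<subseteq>
          {p \<in> topspace (prod_topology ?T ?T). (case p of (x, y) \<Rightarrow> x \<otimes> y) \<in> U}"
        using openin_Hecke_coset[OF H F' ab(1)] openin_Hecke_coset[OF H F(1,2) ab(2)]
          mem_Hecke_coset[OF H F'(2) ab(1)] mem_Hecke_coset[OF H F(2) ab(2)] by blast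
    qed
  qed
  have inv: "continuous_map ?T ?T (\<lambda>x. inv x)"
    unfolding continuous_map_def
  proof (intro conjI allI impI)
    show "(\<lambda>x. inv x) \<in> topspace ?T \<rightarrow> topspace ?T" by (auto simp: top)
  next
    fix U assume U: "openin ?T U"
    show "openin ?T {x \<in> topspace ?T. inv x \<in> U}"
      unfolding openin_Hecke_topology
    proof (intro conjI ballI)
      show "{x \<in> topspace ?T. inv x \<in> U} \<subseteq> carrier G" by (auto simp: top)
      fix a assume "a \<in> {x \<in> topspace ?T. inv x \<in> U}"
      then have a: "a \<in> carrier G" "inv a \<in> U" by (auto simp: top)
      obtain F where F: "finite F" "F \<subseteq> carrier G" "inv a <# ?V F \<subseteq> U"
        using U a(2) unfolding openin_Hecke_topology by blast
      define F' where "F' = (\<lambda>x. inv a \<otimes> x) ` F"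
      have F': "finite F'" "F' \<subseteq> carrier G" using F a by (auto simp: F'_def)
      have V': "subgroup (?V F') G" using H F' by (rule_tac subgroup_Hecke_nbhd)
      have "inv (a \<otimes> v) \<in> U" if v: "v \<in> ?V F'" for v
      proof -
        have c: "v \<in> carrier G" using v by (auto simp: Hecke_nbhd_def)
        have "inv v \<in> ?V F'" using v V' by (simp add: subgroup.m_inv_closed)
        then have "a \<otimes> inv v \<otimes> inv a \<in> ?V F"
          using mem_Hecke_nbhd_conj[OF H F(2), of "inv a" "inv v"] a by (simp add: F'_def)
        then have "inv a \<otimes> (a \<otimes> inv v \<otimes> inv a) \<in> U"
          using F(3) by (auto simp: l_coset_def)
        moreover have "inv a \<otimes> (a \<otimes> inv v \<otimes> inv a) = (inv a \<otimes> a) \<otimes> inv v \<otimes> inv a"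
          using a c by (simp only: m_assoc inv_closed m_closed)
        ultimately show ?thesis using a c by (simp add: inv_mult_group)
      qed
      then have "a <# ?V F' \<subseteq> {x \<in> topspace ?T. inv x \<in> U}"
        using a by (auto simp: l_coset_def top Hecke_nbhd_def)
      with F' show "\<exists>F. finite F \<and> F \<subseteq> carrier G \<and> a <# ?V F \<subseteq> {x \<in> topspace ?T. inv x \<in> U}"
        by blast
    qed
  qed
  show ?thesis
    by (intro topological_group.intro topological_group_axioms.intro is_group top mult inv)
qed

end

text \<open>The completion is only determined up to isomorphism, so it is given as a predicate; \<open>\<iota>\<close> is the
  embedding of \<open>G\<close> into \<open>K\<close>, which identifies \<open>G\<close> with a dense subgroup of \<open>K\<close>.\<close>

definition Schlichting_completion ::
    "('a, 'c) monoid_scheme \<Rightarrow> 'a set \<Rightarrow> ('b, 'd) monoid_scheme \<Rightarrow> 'b topology \<Rightarrow> 'b set \<Rightarrow> ('a \<Rightarrow> 'b) \<Rightarrow> bool"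
  where
  "Schlichting_completion G H K TK Hbar \<iota> \<longleftrightarrow>
     reduced_Hecke_pair G H \<and>
     group_completion G (Hecke_topology G H) K TK \<iota> \<and>
     Hbar = TK closure_of (\<iota> ` H)"


section \<open>Semidirect products\<close>

definition internal_semidirect :: "('a, 'c) monoid_scheme \<Rightarrow> 'a set \<Rightarrow> 'a set \<Rightarrow> bool" where
  "internal_semidirect K L S \<longleftrightarrow>
     L \<lhd> K \<and> subgroup S K \<and> L <#>\<^bsub>K\<^esub> S = carrier K \<and> L \<inter> S = {\<one>\<^bsub>K\<^esub>}"

definition topological_semidirect ::
    "('a, 'c) monoid_scheme \<Rightarrow> 'a topology \<Rightarrow> 'a set \<Rightarrow> 'a set \<Rightarrow> bool" where
  "topological_semidirect K T L S \<longleftrightarrow>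
     internal_semidirect K L S \<and>
     homeomorphic_map (prod_topology (subtopology T L) (subtopology T S)) T (\<lambda>(l, s). l \<otimes>\<^bsub>K\<^esub> s)"

end

theory Submission
  imports Defs
begin

text \<open>The projection \<open>G \<rightarrow> Q\<close>, viewed as an endomorphism of \<open>G\<close>, is continuous in the Hecke topology because
  \<open>M\<close> is normal in \<open>N\<close>. It therefore extends to a continuous endomorphism \<open>p\<close> of the completion that is
  idempotent on \<open>G\<close>. A continuous endomorphism that restricts to an idempotent of a subgroup \<open>A\<close> splits
  the closure of \<open>A\<close> as the closure of \<open>A \<inter> ker p\<close> times the closure of \<open>p(A)\<close>; the cases
  \<open>A = G\<close> and \<open>A = H\<close> are the two claims.\<close>

section \<open>Topological groups\<close>

context topological_group
begin

lemma continuous_map_mult [continuous_intros]: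
  assumes "continuous_map X T f" "continuous_map X T g"
  shows "continuous_map X T (\<lambda>x. f x \<otimes> g x)"
  using continuous_map_compose[OF continuous_map_pairedI[OF assms] continuous_mult]
  by (simp add: o_def)

lemma continuous_map_m_inv [continuous_intros]:
  assumes "continuous_map X T f"
  shows "continuous_map X T (\<lambda>x. inv (f x))"
  using continuous_map_compose[OF assms continuous_inv] by (simp add: o_def)

text \<open>The map (a, b) \<mapsto> a b^-1 x sends (x, x) to x, a point outside \<open>C\<close>,
  so it maps some box \<open>A\<close> \<times> \<open>B\<close> around (x, x) outside
  \<open>C\<close>. Then \<open>A\<close> misses every translate c x^-1 B with c in
  \<open>C\<close>. Regularity of the target group later turns pointwise limits into a continuous
  extension.\<close>

lemma regular_space_topological_group: "regular_space T"
  unfolding regular_space_def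
proof (intro allI impI)
  fix C x assume "closedin T C \<and> x \<in> topspace T - C"
  then have C: "closedin T C" and x: "x \<in> carrier K" "x \<notin> C" by (auto simp: topspace_eq)
  have CK: "C \<subseteq> carrier K" using closedin_subset[OF C] topspace_eq by simp
  let ?P = "{p \<in> topspace (prod_topology T T). fst p \<otimes> (inv (snd p) \<otimes> x) \<in> topspace T - C}"
  have "continuous_map (prod_topology T T) T (\<lambda>p. fst p \<otimes> (inv (snd p) \<otimes> x))"
    by (intro continuous_intros) (auto simp: topspace_eq x)
  then have "openin (prod_topology T T) ?P"
    using C by (intro openin_continuous_map_preimage) auto
  moreover have "(x, x) \<in> ?P" using x by (simp add: topspace_eq)
  ultimately obtain A B where A: "openin T A" "x \<in> A" and B: "openin T B" "x \<in> B"
    and AB: "A \<times> B \<subseteq> ?P"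
    unfolding openin_prod_topology_alt by meson
  \<comment> \<open>The set indexed by c is the translate c x^-1 B; it contains c because x lies in
    \<open>B\<close>.\<close>
  define V where "V = (\<Union>c\<in>C. {y \<in> topspace T. x \<otimes> inv c \<otimes> y \<in> B})"
  have "openin T {y \<in> topspace T. x \<otimes> inv c \<otimes> y \<in> B}" if "c \<in> C" for c
    using that CK x B
    by (intro openin_continuous_map_preimage[where Y=T] continuous_intros) (auto simp: topspace_eq)
  then have "openin T V" by (auto simp: V_def)
  moreover have "C \<subseteq> V"
  proof
    fix c assume "c \<in> C"
    moreover from this have "x \<otimes> inv c \<otimes> c = x" using CK x by (simp add: m_assoc subsetD)
    ultimately show "c \<in> V" using CK B by (auto simp: V_def topspace_eq intro!: bexI[of _ c])
  qed
  moreover have False if a: "a \<in> A" "a \<in> V" for a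
  proof -
    obtain c where c: "c \<in> C" "a \<in> carrier K" "x \<otimes> inv c \<otimes> a \<in> B"
      using a by (auto simp: V_def topspace_eq)
    then have cK: "c \<in> carrier K" using CK by auto
    have "a \<otimes> (inv (x \<otimes> inv c \<otimes> a) \<otimes> x) = (a \<otimes> inv a) \<otimes> c \<otimes> (inv x \<otimes> x)"
      using c(2) cK x(1) by (simp only: inv_mult_group inv_inv m_assoc inv_closed m_closed)
    also have "\<dots> = c" using c(2) cK x(1) by simp
    finally have "(a, x \<otimes> inv c \<otimes> a) \<notin> ?P" using c(1) by simp
    then show False using AB a(1) c(3) by blast
  qed
  ultimately show "\<exists>U V. openin T U \<and> openin T V \<and> x \<in> U \<and> C \<subseteq> V \<and> disjnt U V"
    using A by (auto simp: disjnt_iff)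
qed

lemma subgroup_closure_of:
  assumes A: "subgroup A K"
  shows "subgroup (T closure_of A) K"
proof (rule subgroupI)
  show "T closure_of A \<subseteq> carrier K"
    using closure_of_subset_topspace[of T A] by (simp add: topspace_eq)
  have "A \<subseteq> T closure_of A"
    using subgroup.subset[OF A] by (simp add: closure_of_subset topspace_eq)
  then show "T closure_of A \<noteq> {}" using subgroup.one_closed[OF A] by blast
next
  fix a assume a: "a \<in> T closure_of A"
  have "(\<lambda>x. inv x) ` (T closure_of A) \<subseteq> T closure_of ((\<lambda>x. inv x) ` A)"
    by (rule continuous_map_image_closure_subset[OF continuous_inv])
  also have "\<dots> \<subseteq> T closure_of A"
    using subgroup.m_inv_closed[OF A] by (intro closure_of_mono) auto
  finally show "inv a \<in> T closure_of A" using a by blast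
next
  fix a b assume ab: "a \<in> T closure_of A" "b \<in> T closure_of A"
  have "(\<lambda>(x, y). x \<otimes> y) ` ((T closure_of A) \<times> (T closure_of A))
      \<subseteq> T closure_of ((\<lambda>(x, y). x \<otimes> y) ` (A \<times> A))"
    using continuous_map_image_closure_subset[OF continuous_mult] by (metis closure_of_Times)
  also have "\<dots> \<subseteq> T closure_of A"
    using subgroup.m_closed[OF A] by (intro closure_of_mono) auto
  finally show "a \<otimes> b \<in> T closure_of A" using ab by auto
qed

text \<open>The retraction \<open>p\<close> splits the closure \<open>B\<close>: the homeomorphism \<open>(l, s) \<mapsto> l s\<close> has the continuous
  inverse \<open>x \<mapsto> (x p(x)\<^sup>-\<^sup>1, p(x))\<close>, whose first component maps \<open>A\<close> into \<open>A \<inter> ker p\<close>.\<close>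

lemma topological_semidirect_closure_of:
  assumes haus: "Hausdorff_space T"
    and p: "p \<in> hom K K" and cp: "continuous_map T T p"
    and A: "subgroup A K" and pA: "p ` A \<subseteq> A" and pp: "\<And>x. x \<in> A \<Longrightarrow> p (p x) = p x"
  defines "B \<equiv> T closure_of A"
  shows "topological_semidirect (K\<lparr>carrier := B\<rparr>) (subtopology T B)
           (T closure_of (A \<inter> kernel K K p)) (T closure_of (p ` A))"
proof -
  define L where "L = T closure_of (A \<inter> kernel K K p)"
  define S where "S = T closure_of (p ` A)"
  interpret p: group_hom K K p by unfold_locales (rule p)
  have A_K: "A \<subseteq> carrier K" by (rule subgroup.subset[OF A])
  have B: "subgroup B K" unfolding B_def by (rule subgroup_closure_of[OF A])
  have B_K: "B \<subseteq> carrier K" by (rule subgroup.subset[OF B])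
  have S: "subgroup S K"
    unfolding S_def by (intro subgroup_closure_of p.subgroup_img_is_subgroup A)
  have SB: "S \<subseteq> B" unfolding S_def B_def by (rule closure_of_mono[OF pA])
  have p_BS: "p x \<in> S" if "x \<in> B" for x
    using continuous_map_image_closure_subset[OF cp, of A] that by (auto simp: B_def S_def)
  \<comment> \<open>Idempotence on \<open>A\<close> gives this identity on p(A). Both sides are
    continuous maps into a Hausdorff space, so it passes to the closure; \<open>p_L\<close> is
    obtained in the same way from the constant value one.\<close>
  have p_S: "p s = s" if "s \<in> S" for s
    using that[unfolded S_def]
    by (rule forall_in_closure_of_eq[OF _ haus cp]) (auto simp: pp)
  define \<sigma> where "\<sigma> x = x \<otimes> inv (p x)" for x
  have c\<sigma>: "continuous_map T T \<sigma>"
    unfolding \<sigma>_def by (intro continuous_intros cp)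
  have \<sigma>_A: "\<sigma> x \<in> A \<inter> kernel K K p" if "x \<in> A" for x
  proof -
    have "x \<in> A" "p x \<in> A" using that pA by auto
    then show ?thesis
      using A_K by (auto simp: \<sigma>_def kernel_def pp subsetD
          intro!: subgroup.m_closed[OF A] subgroup.m_inv_closed[OF A])
  qed
  have \<sigma>_BL: "\<sigma> x \<in> L" if "x \<in> B" for x
  proof -
    have "\<sigma> ` B \<subseteq> T closure_of (\<sigma> ` A)"
      unfolding B_def by (rule continuous_map_image_closure_subset[OF c\<sigma>])
    also have "\<dots> \<subseteq> L" unfolding L_def using \<sigma>_A by (intro closure_of_mono) auto
    finally show ?thesis using that by blast
  qed
  have p_L: "p l = \<one>" if "l \<in> L" for l
    using that[unfolded L_def]
    by (rule forall_in_closure_of_eq[OF _ haus cp]) (auto simp: kernel_def topspace_eq)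
  have LB: "L \<subseteq> B" unfolding L_def B_def by (intro closure_of_mono) auto
  \<comment> \<open>A point of \<open>B\<close> killed by \<open>p\<close> need not lie in
    \<open>A\<close>, but \<open>\<sigma>\<close> fixes it and maps \<open>B\<close> into
    \<open>L\<close>. So the closure of the small kernel is the whole kernel on \<open>B\<close>,
    whence it is normal in \<open>B\<close>.\<close>
  have L_eq: "L = kernel (K\<lparr>carrier := B\<rparr>) K p"
  proof
    show "L \<subseteq> kernel (K\<lparr>carrier := B\<rparr>) K p" using LB p_L by (auto simp: kernel_def)
    show "kernel (K\<lparr>carrier := B\<rparr>) K p \<subseteq> L"
    proof
      fix x assume "x \<in> kernel (K\<lparr>carrier := B\<rparr>) K p"
      then have "x \<in> B" "p x = \<one>" by (auto simp: kernel_def)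
      then show "x \<in> L" using \<sigma>_BL[of x] B_K by (auto simp: \<sigma>_def)
    qed
  qed
  have split: "\<sigma> x \<otimes> p x = x" if "x \<in> B" for x
    using that B_K by (auto simp: \<sigma>_def m_assoc subsetD)
  interpret pB: group_hom "K\<lparr>carrier := B\<rparr>" K p
    using subgroup_imp_group[OF B] p.hom_mult B_K
    by (auto simp: group_hom_def group_hom_axioms_def hom_def subsetD)
  have "internal_semidirect (K\<lparr>carrier := B\<rparr>) L S"
    unfolding internal_semidirect_def
  proof (intro conjI)
    show "L \<lhd> K\<lparr>carrier := B\<rparr>" unfolding L_eq by (rule pB.normal_kernel)
    show "subgroup S (K\<lparr>carrier := B\<rparr>)" by (rule subgroup_incl[OF S B SB])
    have "L <#> S = B"
    proof
      show "L <#> S \<subseteq> B" using LB SB subgroup.m_closed[OF B] by (auto simp: set_mult_def)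
      show "B \<subseteq> L <#> S" using \<sigma>_BL p_BS split by (force simp: set_mult_def)
    qed
    then show "L <#>\<^bsub>K\<lparr>carrier := B\<rparr>\<^esub> S = carrier (K\<lparr>carrier := B\<rparr>)"
      by (simp add: set_mult_def)
    have "x = \<one>" if "x \<in> L" "x \<in> S" for x using that p_L p_S by metis
    moreover have "\<one> \<in> S" by (rule subgroup.one_closed[OF S])
    moreover have "\<one> \<in> L"
      using subgroup.one_closed[OF pB.subgroup_kernel] by (simp add: L_eq)
    ultimately have "L \<inter> S = {\<one>}" by blast
    then show "L \<inter> S = {\<one>\<^bsub>K\<lparr>carrier := B\<rparr>\<^esub>}" by simp
  qed
  moreover have "homeomorphic_maps (prod_topology (subtopology T L) (subtopology T S))
      (subtopology T B) (\<lambda>(l, s). l \<otimes> s) (\<lambda>x. (\<sigma> x, p x))"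
    unfolding homeomorphic_maps_def
  proof (intro conjI ballI)
    have "continuous_map (prod_topology (subtopology T L) (subtopology T S)) T (\<lambda>z. fst z \<otimes> snd z)"
      by (intro continuous_map_mult continuous_map_into_fulltopology[OF continuous_map_fst]
          continuous_map_into_fulltopology[OF continuous_map_snd])
    then show "continuous_map (prod_topology (subtopology T L) (subtopology T S))
        (subtopology T B) (\<lambda>(l, s). l \<otimes> s)"
      by (auto simp: case_prod_unfold continuous_map_in_subtopology
          intro!: subgroup.m_closed[OF B] intro: subsetD[OF LB] subsetD[OF SB])
    show "continuous_map (subtopology T B) (prod_topology (subtopology T L) (subtopology T S))
        (\<lambda>x. (\<sigma> x, p x))"
      using \<sigma>_BL p_BS
      by (intro continuous_map_pairedI continuous_map_into_subtopology
          continuous_map_from_subtopology c\<sigma> cp) auto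
  next
    fix z assume "z \<in> topspace (prod_topology (subtopology T L) (subtopology T S))"
    then obtain l s where z: "z = (l, s)" and ls: "l \<in> L" "s \<in> S" by auto
    have lsK: "l \<in> carrier K" "s \<in> carrier K" using ls LB SB B_K by auto
    then have "p (l \<otimes> s) = s" using p_L[OF ls(1)] p_S[OF ls(2)] by simp
    then show "(\<lambda>x. (\<sigma> x, p x)) (case z of (l, s) \<Rightarrow> l \<otimes> s) = z"
      using lsK by (simp add: z \<sigma>_def m_assoc)
  next
    fix x assume "x \<in> topspace (subtopology T B)"
    then show "(case (\<sigma> x, p x) of (l, s) \<Rightarrow> l \<otimes> s) = x" using split by simp
  qed
  ultimately show ?thesis
    unfolding topological_semidirect_def L_def[symmetric] S_def[symmetric]
    using homeomorphic_maps_imp_map LB SB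
    by (fastforce simp: case_prod_unfold subtopology_subtopology Int_absorb1)
qed


lemma topological_group_subgroup:
  assumes D: "subgroup D K"
  shows "topological_group (K\<lparr>carrier := D\<rparr>) (subtopology T D)"
proof -
  interpret D: group "K\<lparr>carrier := D\<rparr>" by (rule subgroup_imp_group[OF D])
  have D_K: "D \<subseteq> carrier K" by (rule subgroup.subset[OF D])
  have "continuous_map (prod_topology (subtopology T D) (subtopology T D)) T (\<lambda>z. fst z \<otimes> snd z)"
    by (intro continuous_map_mult continuous_map_into_fulltopology[OF continuous_map_fst]
        continuous_map_into_fulltopology[OF continuous_map_snd])
  moreover have "continuous_map (subtopology T D) T (\<lambda>x. inv x)"
    by (rule continuous_map_from_subtopology[OF continuous_inv])
  then have "continuous_map (subtopology T D) T (\<lambda>x. inv\<^bsub>K\<lparr>carrier := D\<rparr>\<^esub> x)"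
    by (rule continuous_map_eq) (auto simp: m_inv_consistent[OF D])
  ultimately show ?thesis
    using D_K subgroup.m_closed[OF D] D.inv_closed
    by unfold_locales (auto simp: topspace_eq case_prod_unfold continuous_map_in_subtopology)
qed

end

section \<open>Extension of homomorphisms to completions\<close>

text \<open>Left translations are continuous in both groups, and h y = h x \<otimes> h (x^-1 y)
  carries the condition at the identity over to an arbitrary point x.\<close>

lemma continuous_map_hom_at_one:
  assumes "topological_group G T" "topological_group K TK" and h: "h \<in> hom G K"
    and at_one: "\<And>U. openin TK U \<Longrightarrow> \<one>\<^bsub>K\<^esub> \<in> U \<Longrightarrow> \<exists>V. openin T V \<and> \<one>\<^bsub>G\<^esub> \<in> V \<and> h ` V \<subseteq> U"
  shows "continuous_map T TK h"
proof -
  interpret G: topological_group G T by fact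
  interpret K: topological_group K TK by fact
  interpret h: group_hom G K h by unfold_locales (rule h)
  show ?thesis
    unfolding continuous_map_def
  proof (intro conjI allI impI)
    show "h \<in> topspace T \<rightarrow> topspace TK" by (auto simp: G.topspace_eq K.topspace_eq)
    fix U assume U: "openin TK U"
    have "\<exists>W. openin T W \<and> x \<in> W \<and> W \<subseteq> {x \<in> topspace T. h x \<in> U}"
      if x: "x \<in> carrier G" "h x \<in> U" for x
    proof -
      have "openin TK {u \<in> topspace TK. h x \<otimes>\<^bsub>K\<^esub> u \<in> U}"
        using x U by (intro openin_continuous_map_preimage[where Y=TK] K.continuous_map_mult)
          (auto simp: K.topspace_eq)
      moreover have "\<one>\<^bsub>K\<^esub> \<in> {u \<in> topspace TK. h x \<otimes>\<^bsub>K\<^esub> u \<in> U}" using x by (auto simp: K.topspace_eq)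
      ultimately obtain V where V: "openin T V" "\<one>\<^bsub>G\<^esub> \<in> V"
        and hV: "h ` V \<subseteq> {u \<in> topspace TK. h x \<otimes>\<^bsub>K\<^esub> u \<in> U}"
        using at_one by meson
      define W where "W = {y \<in> topspace T. inv\<^bsub>G\<^esub> x \<otimes>\<^bsub>G\<^esub> y \<in> V}"
      have "openin T W" unfolding W_def
        using x V by (intro openin_continuous_map_preimage[where Y=T] G.continuous_map_mult)
          (auto simp: G.topspace_eq)
      moreover have "x \<in> W" using x V by (auto simp: W_def G.topspace_eq)
      moreover have "h y \<in> U" if "y \<in> W" for y
      proof -
        have y: "y \<in> carrier G" "inv\<^bsub>G\<^esub> x \<otimes>\<^bsub>G\<^esub> y \<in> V" using that by (auto simp: W_def G.topspace_eq)
        then have "h x \<otimes>\<^bsub>K\<^esub> h (inv\<^bsub>G\<^esub> x \<otimes>\<^bsub>G\<^esub> y) \<in> U" using hV by blast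
        also have "h x \<otimes>\<^bsub>K\<^esub> h (inv\<^bsub>G\<^esub> x \<otimes>\<^bsub>G\<^esub> y) = h (x \<otimes>\<^bsub>G\<^esub> (inv\<^bsub>G\<^esub> x \<otimes>\<^bsub>G\<^esub> y))"
          using x y(1) by (intro h.hom_mult[symmetric]) auto
        also have "x \<otimes>\<^bsub>G\<^esub> (inv\<^bsub>G\<^esub> x \<otimes>\<^bsub>G\<^esub> y) = y" using x y(1) by (simp add: G.m_assoc[symmetric])
        finally show ?thesis .
      qed
      ultimately show ?thesis by (auto simp: W_def)
    qed
    then show "openin T {x \<in> topspace T. h x \<in> U}"
      by (subst openin_subopen) (auto simp: G.topspace_eq)
  qed
qed

text \<open>The entourage of an intersection of two neighbourhoods lies in both of their entourages.
  The basic entourages thus form a filter base, and a single one witnesses membership in the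
  infimum.\<close>

lemma (in topological_group) eventually_two_sided_uniformity:
  "eventually P (two_sided_uniformity K T) \<longleftrightarrow>
    (\<exists>U. openin T U \<and> \<one> \<in> U \<and>
      (\<forall>x\<in>carrier K. \<forall>y\<in>carrier K. inv x \<otimes> y \<in> U \<and> y \<otimes> inv x \<in> U \<longrightarrow> P (x, y)))"
proof -
  have "openin T (topspace T) \<and> \<one> \<in> topspace T" using openin_topspace[of T] by (simp add: topspace_eq)
  then have ne: "{U. openin T U \<and> \<one> \<in> U} \<noteq> {}" by blast
  show ?thesis
    unfolding two_sided_uniformity_def
    apply (subst eventually_INF_base[OF ne])
    subgoal for A B by (rule bexI[of _ "A \<inter> B"]) auto
    by (auto simp: eventually_principal)
qed

text \<open>The neighbourhoods of x, traced on \<open>D\<close> and pushed forward by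
  \<open>f\<close>, form a Cauchy filter in \<open>L\<close>, so completeness yields a limit.
  Regularity of \<open>L\<close> makes the limits a continuous map \<open>g\<close>, and density
  together with the Hausdorff property makes \<open>g\<close> multiplicative.\<close>

lemma hom_extension_two_sided_complete:
  assumes "topological_group K T" "topological_group L T'"
    and haus: "Hausdorff_space T'" and complete: "two_sided_complete L T'"
    and D: "subgroup D K" and dense: "T closure_of D = carrier K"
    and f: "f \<in> hom (K\<lparr>carrier := D\<rparr>) L" and cf: "continuous_map (subtopology T D) T' f"
  obtains g where "g \<in> hom K L" "continuous_map T T' g" "\<And>x. x \<in> D \<Longrightarrow> g x = f x"
proof -
  interpret K: topological_group K T by fact
  interpret L: topological_group L T' by fact
  interpret f: group_hom "K\<lparr>carrier := D\<rparr>" L f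
    using f by (auto simp: group_hom_def group_hom_axioms_def K.subgroup_imp_group[OF D] L.is_group)
  have D_K: "D \<subseteq> carrier K" by (rule subgroup.subset[OF D])
  have fD: "f a \<in> carrier L" if "a \<in> D" for a using f.hom_closed that by simp
  have f_div: "inv\<^bsub>L\<^esub> (f a) \<otimes>\<^bsub>L\<^esub> f b = f (inv\<^bsub>K\<^esub> a \<otimes>\<^bsub>K\<^esub> b)"
    "f b \<otimes>\<^bsub>L\<^esub> inv\<^bsub>L\<^esub> (f a) = f (b \<otimes>\<^bsub>K\<^esub> inv\<^bsub>K\<^esub> a)" if "a \<in> D" "b \<in> D" for a b
    using that f.hom_inv[of a] f.hom_mult subgroup.m_inv_closed[OF D]
    by (simp_all add: K.m_inv_consistent[OF D])
  have "\<exists>l. limitin T' f l (atin_within T x D)" if x: "x \<in> carrier K" for x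
  proof -
    define F where "F = filtermap f (inf (nhdsin T x) (principal D))"
    have ev: "eventually P F \<longleftrightarrow> (\<exists>W. openin T W \<and> x \<in> W \<and> (\<forall>a\<in>W \<inter> D. P (f a)))" for P
      using x unfolding F_def
      by (auto simp: eventually_filtermap eventually_inf_principal eventually_nhdsin K.topspace_eq)
    \<comment> \<open>Properness of \<open>F\<close> is exactly the density of \<open>D\<close> at
      x.\<close>
    have "F \<noteq> bot"
    proof
      assume "F = bot"
      then have "eventually (\<lambda>_. False) F" by simp
      then obtain W where "openin T W" "x \<in> W" "W \<inter> D = {}" unfolding ev by blast
      moreover have "x \<in> T closure_of D" using x dense by simp
      ultimately show False unfolding in_closure_of by blast
    qed
    moreover have "F \<le> principal (carrier L)"
      unfolding le_principal ev
      using fD x openin_topspace[of T] by (intro exI[of _ "topspace T"]) (auto simp: K.topspace_eq)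
    moreover have "F \<times>\<^sub>F F \<le> two_sided_uniformity L T'"
    proof (rule filter_leI)
      fix P assume "eventually P (two_sided_uniformity L T')"
      then obtain U where U: "openin T' U" "\<one>\<^bsub>L\<^esub> \<in> U"
        and P: "\<And>x y. x \<in> carrier L \<Longrightarrow> y \<in> carrier L \<Longrightarrow> inv\<^bsub>L\<^esub> x \<otimes>\<^bsub>L\<^esub> y \<in> U \<Longrightarrow>
            y \<otimes>\<^bsub>L\<^esub> inv\<^bsub>L\<^esub> x \<in> U \<Longrightarrow> P (x, y)"
        unfolding L.eventually_two_sided_uniformity by blast
      have "openin (subtopology T D) {a \<in> topspace (subtopology T D). f a \<in> U}"
        by (rule openin_continuous_map_preimage[OF cf U(1)])
      then obtain V where V: "openin T V" "{a \<in> topspace (subtopology T D). f a \<in> U} = V \<inter> D"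
        unfolding openin_subtopology by blast
      have fV: "f a \<in> U" if "a \<in> V" "a \<in> D" for a using V(2) that by blast
      have "\<one>\<^bsub>K\<^esub> \<in> {a \<in> topspace (subtopology T D). f a \<in> U}"
        using f.hom_one U(2) subgroup.one_closed[OF D] by (simp add: K.topspace_eq)
      then have V1: "\<one>\<^bsub>K\<^esub> \<in> V" using V(2) by blast
      \<comment> \<open>Both quotients a^-1 b and b a^-1 have to be small, as the uniformity is
        two-sided. Both equal one at (x, x), so a box \<open>A\<close> \<times> \<open>B\<close>
        around that point lies in \<open>?E\<close>; intersecting its sides gives one neighbourhood
        whose points in \<open>D\<close> are pairwise close.\<close>
      let ?E = "{p \<in> topspace (prod_topology T T). inv\<^bsub>K\<^esub> (fst p) \<otimes>\<^bsub>K\<^esub> snd p \<in> V} \<inter>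
        {p \<in> topspace (prod_topology T T). snd p \<otimes>\<^bsub>K\<^esub> inv\<^bsub>K\<^esub> (fst p) \<in> V}"
      have "openin (prod_topology T T) ?E"
        by (intro openin_Int openin_continuous_map_preimage[OF _ V(1)] K.continuous_map_mult
            K.continuous_map_m_inv continuous_map_fst continuous_map_snd)
      moreover have "(x, x) \<in> ?E" using x V1 by (simp add: K.topspace_eq)
      ultimately obtain A B where A: "openin T A" "x \<in> A" and B: "openin T B" "x \<in> B"
        and AB: "A \<times> B \<subseteq> ?E"
        unfolding openin_prod_topology_alt by meson
      have "P (f a, f b)" if "a \<in> A \<inter> B \<inter> D" "b \<in> A \<inter> B \<inter> D" for a b
      proof (rule P)
        have ab: "a \<in> D" "b \<in> D" "inv\<^bsub>K\<^esub> a \<otimes>\<^bsub>K\<^esub> b \<in> V" "b \<otimes>\<^bsub>K\<^esub> inv\<^bsub>K\<^esub> a \<in> V"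
          using that AB by auto
        show "f a \<in> carrier L" "f b \<in> carrier L" using ab fD by auto
        show "inv\<^bsub>L\<^esub> (f a) \<otimes>\<^bsub>L\<^esub> f b \<in> U" "f b \<otimes>\<^bsub>L\<^esub> inv\<^bsub>L\<^esub> (f a) \<in> U"
          unfolding f_div[OF ab(1,2)] using ab subgroup.m_inv_closed[OF D] subgroup.m_closed[OF D]
          by (auto intro!: fV)
      qed
      moreover have "eventually (\<lambda>y. y \<in> f ` (A \<inter> B \<inter> D)) F"
        unfolding ev using A B by (intro exI[of _ "A \<inter> B"]) auto
      ultimately show "eventually P (F \<times>\<^sub>F F)"
        unfolding eventually_prod_same by (intro exI[of _ "\<lambda>y. y \<in> f ` (A \<inter> B \<inter> D)"]) blast
    qed
    ultimately obtain l where l: "l \<in> carrier L" "F \<le> nhdsin T' l"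
      using complete unfolding two_sided_complete_def by blast
    \<comment> \<open>The filter \<open>atin_within\<close> omits x itself, so convergence of
      \<open>F\<close> is at least as strong as the limit asked for.\<close>
    have "eventually (\<lambda>a. f a \<in> U) (atin_within T x D)" if U: "openin T' U" "l \<in> U" for U
    proof -
      have "eventually (\<lambda>y. y \<in> U) F"
        by (rule filter_leD[OF l(2)]) (use U in \<open>auto simp: eventually_nhdsin\<close>)
      then show ?thesis unfolding ev eventually_atin_within by blast
    qed
    then show ?thesis using l(1) by (auto simp: limitin_def L.topspace_eq)
  qed
  then obtain g where cg: "continuous_map (subtopology T (carrier K)) T' g" and gf: "\<And>x. x \<in> D \<Longrightarrow> g x = f x"
    using continuous_map_extension_pointwise_alt[OF L.regular_space_topological_group D_K _ cf]
      dense by (metis Diff_iff order_refl)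
  then have cg: "continuous_map T T' g" using K.topspace_eq by (metis subtopology_topspace)
  have g_mult: "g (x \<otimes>\<^bsub>K\<^esub> y) = g x \<otimes>\<^bsub>L\<^esub> g y" if "x \<in> carrier K" "y \<in> carrier K" for x y
  proof -
    \<comment> \<open>Multiplicativity is an equation between two continuous maps on the product
      that holds on the dense subset \<open>D\<close> \<times> \<open>D\<close>.\<close>
    have "(x, y) \<in> prod_topology T T closure_of (D \<times> D)"
      using that dense by (simp add: closure_of_Times)
    then have "g (fst (x, y) \<otimes>\<^bsub>K\<^esub> snd (x, y)) = g (fst (x, y)) \<otimes>\<^bsub>L\<^esub> g (snd (x, y))"
    proof (rule forall_in_closure_of_eq[OF _ haus])
      have "continuous_map (prod_topology T T) T' (g \<circ> (\<lambda>z. fst z \<otimes>\<^bsub>K\<^esub> snd z))"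
        by (intro continuous_map_compose[OF _ cg] K.continuous_map_mult continuous_map_fst continuous_map_snd)
      then show "continuous_map (prod_topology T T) T' (\<lambda>z. g (fst z \<otimes>\<^bsub>K\<^esub> snd z))" by (simp add: o_def)
      show "continuous_map (prod_topology T T) T' (\<lambda>z. g (fst z) \<otimes>\<^bsub>L\<^esub> g (snd z))"
        using continuous_map_compose[OF continuous_map_fst cg] continuous_map_compose[OF continuous_map_snd cg]
        by (intro L.continuous_map_mult) (simp_all add: o_def)
      show "g (fst z \<otimes>\<^bsub>K\<^esub> snd z) = g (fst z) \<otimes>\<^bsub>L\<^esub> g (snd z)" if "z \<in> D \<times> D" for z
        using that f.hom_mult gf subgroup.m_closed[OF D] by auto
    qed
    then show ?thesis by simp
  qed
  have "g \<in> hom K L"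
    using g_mult continuous_map_image_subset_topspace[OF cg]
    by (auto simp: hom_def K.topspace_eq L.topspace_eq)
  with cg gf show thesis using that by blast
qed

section \<open>Universal property of the two-sided completion\<close>

text \<open>The completion is specified through entourages. Testing these on pairs whose first entry
  is the identity turns the equality of uniformities into a comparison of neighbourhoods of the
  identity: the first half gives continuity of \<open>\<iota>\<close>, the second continuity of its
  inverse on the image.\<close>

lemma group_completion_nbhds:
  assumes comp: "group_completion G T K TK \<iota>"
  shows "openin TK U \<Longrightarrow> \<one>\<^bsub>K\<^esub> \<in> U \<Longrightarrow> \<exists>V. openin T V \<and> \<one>\<^bsub>G\<^esub> \<in> V \<and> \<iota> ` V \<subseteq> U"
    and "openin T V \<Longrightarrow> \<one>\<^bsub>G\<^esub> \<in> V \<Longrightarrow>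
      \<exists>U. openin TK U \<and> \<one>\<^bsub>K\<^esub> \<in> U \<and> (\<forall>x\<in>carrier G. \<iota> x \<in> U \<longrightarrow> x \<in> V)"
proof -
  interpret G: topological_group G T using comp by (simp add: group_completion_def)
  interpret K: topological_group K TK using comp by (simp add: group_completion_def)
  interpret \<iota>: group_hom G K \<iota> by unfold_locales (use comp in \<open>simp add: group_completion_def\<close>)
  have unif: "eventually P (two_sided_uniformity G T) \<longleftrightarrow>
      (\<exists>Q. eventually Q (two_sided_uniformity K TK) \<and>
        (\<forall>x\<in>carrier G. \<forall>y\<in>carrier G. Q (\<iota> x, \<iota> y) \<longrightarrow> P (x, y)))" for P
    using comp
    by (auto simp: group_completion_def inf_commute[of "principal _"] eventually_inf_principal
        eventually_filtercomap)
  show "\<exists>V. openin T V \<and> \<one>\<^bsub>G\<^esub> \<in> V \<and> \<iota> ` V \<subseteq> U" if U: "openin TK U" "\<one>\<^bsub>K\<^esub> \<in> U"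
  proof -
    have "eventually (\<lambda>p. inv\<^bsub>K\<^esub> (fst p) \<otimes>\<^bsub>K\<^esub> snd p \<in> U) (two_sided_uniformity K TK)"
      unfolding K.eventually_two_sided_uniformity using U by auto
    then have "eventually (\<lambda>p. inv\<^bsub>K\<^esub> (\<iota> (fst p)) \<otimes>\<^bsub>K\<^esub> \<iota> (snd p) \<in> U) (two_sided_uniformity G T)"
      unfolding unif by (intro exI conjI, assumption) auto
    then obtain V where V: "openin T V" "\<one>\<^bsub>G\<^esub> \<in> V"
      and VU: "\<And>x y. x \<in> carrier G \<Longrightarrow> y \<in> carrier G \<Longrightarrow> inv\<^bsub>G\<^esub> x \<otimes>\<^bsub>G\<^esub> y \<in> V \<Longrightarrow> y \<otimes>\<^bsub>G\<^esub> inv\<^bsub>G\<^esub> x \<in> V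
        \<Longrightarrow> inv\<^bsub>K\<^esub> (\<iota> x) \<otimes>\<^bsub>K\<^esub> \<iota> y \<in> U"
      unfolding G.eventually_two_sided_uniformity by auto
    have "V \<subseteq> carrier G" using openin_subset[OF V(1)] by (simp add: G.topspace_eq)
    then have "\<iota> ` V \<subseteq> U" using VU[of "\<one>\<^bsub>G\<^esub>"] by (auto simp: subsetD)
    with V show ?thesis by blast
  qed
  show "\<exists>U. openin TK U \<and> \<one>\<^bsub>K\<^esub> \<in> U \<and> (\<forall>x\<in>carrier G. \<iota> x \<in> U \<longrightarrow> x \<in> V)"
    if V: "openin T V" "\<one>\<^bsub>G\<^esub> \<in> V"
  proof -
    have "eventually (\<lambda>p. inv\<^bsub>G\<^esub> (fst p) \<otimes>\<^bsub>G\<^esub> snd p \<in> V) (two_sided_uniformity G T)"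
      unfolding G.eventually_two_sided_uniformity using V by auto
    then obtain Q where Q: "eventually Q (two_sided_uniformity K TK)"
      and QV: "\<And>x y. x \<in> carrier G \<Longrightarrow> y \<in> carrier G \<Longrightarrow> Q (\<iota> x, \<iota> y) \<Longrightarrow> inv\<^bsub>G\<^esub> x \<otimes>\<^bsub>G\<^esub> y \<in> V"
      unfolding unif by auto
    from Q obtain U where U: "openin TK U" "\<one>\<^bsub>K\<^esub> \<in> U"
      and UQ: "\<And>x y. x \<in> carrier K \<Longrightarrow> y \<in> carrier K \<Longrightarrow> inv\<^bsub>K\<^esub> x \<otimes>\<^bsub>K\<^esub> y \<in> U \<Longrightarrow> y \<otimes>\<^bsub>K\<^esub> inv\<^bsub>K\<^esub> x \<in> U
        \<Longrightarrow> Q (x, y)"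
      unfolding K.eventually_two_sided_uniformity by blast
    have "x \<in> V" if "x \<in> carrier G" "\<iota> x \<in> U" for x
      using QV[of "\<one>\<^bsub>G\<^esub>" x] UQ[of "\<one>\<^bsub>K\<^esub>" "\<iota> x"] that by simp
    with U show ?thesis by blast
  qed
qed

lemma continuous_map_group_completion:
  assumes "group_completion G T K TK \<iota>"
  shows "continuous_map T TK \<iota>"
  using assms by (intro continuous_map_hom_at_one[of G T K TK] group_completion_nbhds(1))
    (auto simp: group_completion_def)

text \<open>Since \<open>\<iota>\<close> is injective, \<open>\<phi>\<close> transports to a
  homomorphism \<open>f\<close> on the dense subgroup \<iota>(G). Its continuity needs checking only
  at the identity, where the neighbourhoods of \<open>G\<close> are induced from \<open>K\<close>;
  the extension result for dense subgroups then applies.\<close>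

lemma group_completion_extend_hom:
  assumes comp: "group_completion G T K TK \<iota>"
    and L: "topological_group L T'" "Hausdorff_space T'" "two_sided_complete L T'"
    and \<phi>: "\<phi> \<in> hom G L" and c\<phi>: "continuous_map T T' \<phi>"
  obtains g where "g \<in> hom K L" "continuous_map TK T' g" "\<And>x. x \<in> carrier G \<Longrightarrow> g (\<iota> x) = \<phi> x"
proof -
  interpret G: topological_group G T using comp by (simp add: group_completion_def)
  interpret K: topological_group K TK using comp by (simp add: group_completion_def)
  interpret L: topological_group L T' by fact
  interpret \<iota>: group_hom G K \<iota> by unfold_locales (use comp in \<open>simp add: group_completion_def\<close>)
  interpret \<phi>: group_hom G L \<phi> by unfold_locales (rule \<phi>)
  have inj: "inj_on \<iota> (carrier G)" and dense: "TK closure_of (\<iota> ` carrier G) = carrier K"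
    using comp by (auto simp: group_completion_def)
  define D where "D = \<iota> ` carrier G"
  have D: "subgroup D K" unfolding D_def by (rule \<iota>.subgroup_img_is_subgroup[OF G.subgroup_self])
  define f where "f = \<phi> \<circ> inv_into (carrier G) \<iota>"
  have f: "f (\<iota> x) = \<phi> x" if "x \<in> carrier G" for x using that inj by (simp add: f_def)
  have f_hom: "f \<in> hom (K\<lparr>carrier := D\<rparr>) L"
  proof (rule homI)
    fix a b assume "a \<in> carrier (K\<lparr>carrier := D\<rparr>)" "b \<in> carrier (K\<lparr>carrier := D\<rparr>)"
    then obtain x y where xy: "x \<in> carrier G" "y \<in> carrier G" "a = \<iota> x" "b = \<iota> y"
      by (auto simp: D_def)
    then have "f (a \<otimes>\<^bsub>K\<^esub> b) = f (\<iota> (x \<otimes>\<^bsub>G\<^esub> y))" by simp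
    also have "\<dots> = f a \<otimes>\<^bsub>L\<^esub> f b" using xy by (simp add: f del: \<iota>.hom_mult)
    finally show "f (a \<otimes>\<^bsub>K\<lparr>carrier := D\<rparr>\<^esub> b) = f a \<otimes>\<^bsub>L\<^esub> f b" by simp
  qed (auto simp: D_def f)
  have cf: "continuous_map (subtopology TK D) T' f"
  proof (rule continuous_map_hom_at_one[OF K.topological_group_subgroup[OF D] L(1) f_hom])
    fix U assume U: "openin T' U" "\<one>\<^bsub>L\<^esub> \<in> U"
    have "openin T {x \<in> topspace T. \<phi> x \<in> U}" by (rule openin_continuous_map_preimage[OF c\<phi> U(1)])
    then obtain V where V: "openin TK V" "\<one>\<^bsub>K\<^esub> \<in> V" "\<forall>x\<in>carrier G. \<iota> x \<in> V \<longrightarrow> \<phi> x \<in> U"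
      using group_completion_nbhds(2)[OF comp, of "{x \<in> topspace T. \<phi> x \<in> U}"] U
      by (auto simp: G.topspace_eq)
    then show "\<exists>V. openin (subtopology TK D) V \<and> \<one>\<^bsub>K\<lparr>carrier := D\<rparr>\<^esub> \<in> V \<and> f ` V \<subseteq> U"
      using subgroup.one_closed[OF D]
      by (intro exI[of _ "V \<inter> D"]) (auto simp: openin_subtopology D_def f)
  qed
  obtain g where "g \<in> hom K L" "continuous_map TK T' g" "\<And>x. x \<in> D \<Longrightarrow> g x = f x"
    using hom_extension_two_sided_complete[OF K.topological_group_axioms L D _ f_hom cf] dense
    unfolding D_def by blast
  then show thesis using that by (simp add: D_def f)
qed

section \<open>The projection of a semidirect product\<close>

context group
begin

text \<open>If n q = n' q', then q' q^-1 = n'^-1 n lies in N \<inter> Q, so the factor in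
  \<open>Q\<close> is unique and the definite description for \<open>\<pi>\<close> is well defined.
  Multiplicativity follows by moving n' past q, which only conjugates it inside
  \<open>N\<close>.\<close>

lemma internal_semidirect_projection:
  assumes semi: "internal_semidirect G N Q"
  obtains \<pi> where "\<pi> \<in> hom G G" "\<And>n q. n \<in> N \<Longrightarrow> q \<in> Q \<Longrightarrow> \<pi> (n \<otimes> q) = q"
proof -
  have N: "N \<lhd> G" and Q: "subgroup Q G" and NQ: "N <#> Q = carrier G" and int: "N \<inter> Q = {\<one>}"
    using semi by (auto simp: internal_semidirect_def)
  have NG: "subgroup N G" by (rule normal_imp_subgroup[OF N])
  have c: "n \<in> carrier G" if "n \<in> N" for n using that NG by (rule subgroup.mem_carrier[rotated])
  have c': "q \<in> carrier G" if "q \<in> Q" for q using that Q by (rule subgroup.mem_carrier[rotated])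
  have unique: "q = q'" if "n \<in> N" "q \<in> Q" "n' \<in> N" "q' \<in> Q" "n \<otimes> q = n' \<otimes> q'" for n q n' q'
  proof -
    have cc: "n \<in> carrier G" "q \<in> carrier G" "n' \<in> carrier G" "q' \<in> carrier G" using that c c' by auto
    have "inv n' \<otimes> n = inv n' \<otimes> (n \<otimes> q) \<otimes> inv q" using cc by (simp add: m_assoc)
    also have "\<dots> = q' \<otimes> inv q" using cc by (simp add: that(5) m_assoc[symmetric])
    finally have "q' \<otimes> inv q \<in> N \<inter> Q"
      using that NG Q by (metis IntI subgroup.m_closed subgroup.m_inv_closed)
    then have "q' \<otimes> inv q = \<one>" using int by blast
    then show ?thesis using cc by (metis inv_equality inv_inv inv_closed)
  qed
  define \<pi> where "\<pi> x = (THE q. q \<in> Q \<and> (\<exists>n\<in>N. x = n \<otimes> q))" for x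
  have \<pi>: "\<pi> (n \<otimes> q) = q" if "n \<in> N" "q \<in> Q" for n q
    unfolding \<pi>_def using that unique by (intro the_equality) blast+
  moreover have "\<pi> \<in> hom G G"
  proof (rule homI)
    fix x assume "x \<in> carrier G"
    then obtain n q where "n \<in> N" "q \<in> Q" "x = n \<otimes> q" unfolding NQ[symmetric] set_mult_def by blast
    then show "\<pi> x \<in> carrier G" using \<pi> c' by simp
  next
    fix x y assume "x \<in> carrier G" "y \<in> carrier G"
    then obtain n q n' q' where x: "n \<in> N" "q \<in> Q" "x = n \<otimes> q" and y: "n' \<in> N" "q' \<in> Q" "y = n' \<otimes> q'"
      unfolding NQ[symmetric] set_mult_def by blast
    have cc: "n \<in> carrier G" "q \<in> carrier G" "n' \<in> carrier G" "q' \<in> carrier G" using x y c c' by auto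
    have "x \<otimes> y = (n \<otimes> (q \<otimes> n' \<otimes> inv q)) \<otimes> (q \<otimes> q')"
    proof -
      have "(n \<otimes> (q \<otimes> n' \<otimes> inv q)) \<otimes> (q \<otimes> q') = n \<otimes> q \<otimes> n' \<otimes> (inv q \<otimes> q) \<otimes> q'"
        using cc by (simp only: m_assoc inv_closed m_closed)
      then show ?thesis using cc x y by (simp add: m_assoc)
    qed
    moreover have "n \<otimes> (q \<otimes> n' \<otimes> inv q) \<in> N"
      using normal.inv_op_closed2[OF N cc(2) y(1)] x(1) NG by (simp add: subgroup.m_closed)
    moreover have "q \<otimes> q' \<in> Q" using x y Q by (simp add: subgroup.m_closed)
    ultimately show "\<pi> (x \<otimes> y) = \<pi> x \<otimes> \<pi> y" using x y \<pi> by simp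
  qed
  ultimately show thesis using that by blast
qed

text \<open>The heart of the matter: if \<open>h = m r \<in> H \<inter> n H n\<^sup>-\<^sup>1\<close> with \<open>n \<in> N\<close>, then also \<open>r \<in> n H n\<^sup>-\<^sup>1\<close>,
  because \<open>n\<^sup>-\<^sup>1 m n \<in> M\<close>. Writing \<open>x = q n\<close> with \<open>q = \<pi> x\<close>, the
  projection therefore maps \<open>q H q\<^sup>-\<^sup>1 \<inter> x H x\<^sup>-\<^sup>1\<close> into \<open>x H x\<^sup>-\<^sup>1\<close>.\<close>

lemma continuous_map_Hecke_projection:
  assumes semi: "internal_semidirect G N Q"
    and \<pi>: "\<pi> \<in> hom G G" and \<pi>_eq: "\<And>n q. n \<in> N \<Longrightarrow> q \<in> Q \<Longrightarrow> \<pi> (n \<otimes> q) = q"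
    and M: "M \<lhd> G\<lparr>carrier := N\<rparr>" and R: "R \<subseteq> Q"
    and H: "subgroup H G" and MH: "M \<subseteq> H" and MR: "H = M <#> R"
  shows "continuous_map (Hecke_topology G H) (Hecke_topology G H) \<pi>"
proof -
  have N: "N \<lhd> G" and Q: "subgroup Q G" and NQ: "N <#> Q = carrier G"
    using semi by (auto simp: internal_semidirect_def)
  have NG: "subgroup N G" by (rule normal_imp_subgroup[OF N])
  have N_c: "N \<subseteq> carrier G" by (rule subgroup.subset[OF NG])
  have Q_c: "Q \<subseteq> carrier G" by (rule subgroup.subset[OF Q])
  interpret \<pi>: group_hom G G \<pi> by unfold_locales (rule \<pi>)
  have M_N: "M \<subseteq> N" using subgroup.subset[OF normal_imp_subgroup[OF M]] by simp
  have M_conj: "inv n \<otimes> m \<otimes> n \<in> M" if "n \<in> N" "m \<in> M" for n m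
    using normal.inv_op_closed1[OF M, of n m] that by (simp add: m_inv_consistent[OF NG])
  have H_conj: "inv n \<otimes> \<pi> h \<otimes> n \<in> H" if n: "n \<in> N" and h: "h \<in> H" "inv n \<otimes> h \<otimes> n \<in> H" for n h
  proof -
    obtain m r where mr: "m \<in> M" "r \<in> R" "h = m \<otimes> r" using h(1) MR by (auto simp: set_mult_def)
    then have c: "m \<in> carrier G" "r \<in> carrier G" "n \<in> carrier G" and "\<pi> h = r"
      using M_N N_c R Q_c n \<pi>_eq[of m r] by auto
    \<comment> \<open>Dividing the conjugate of h = m r by the conjugate of m, which stays in
      \<open>M\<close>, leaves the conjugate of r.\<close>
    have "inv (inv n \<otimes> m \<otimes> n) \<otimes> (inv n \<otimes> h \<otimes> n) = inv n \<otimes> inv m \<otimes> (n \<otimes> inv n) \<otimes> m \<otimes> r \<otimes> n"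
      using c by (simp only: mr(3) inv_mult_group inv_inv m_assoc inv_closed m_closed)
    also have "\<dots> = inv n \<otimes> (inv m \<otimes> m) \<otimes> r \<otimes> n" using c by (simp add: m_assoc)
    also have "\<dots> = inv n \<otimes> \<pi> h \<otimes> n" using c \<open>\<pi> h = r\<close> by simp
    finally show ?thesis
      using M_conj[OF n mr(1)] MH h(2) subgroup.m_closed[OF H] subgroup.m_inv_closed[OF H]
      by (metis subsetD)
  qed
  have T: "topological_group G (Hecke_topology G H)" by (rule topological_group_Hecke_topology[OF H])
  show ?thesis
  proof (rule continuous_map_hom_at_one[OF T T \<pi>])
    fix U assume U: "openin (Hecke_topology G H) U" "\<one> \<in> U"
    obtain F where F: "finite F" "F \<subseteq> carrier G" "Hecke_nbhd G H F \<subseteq> U"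
      using Hecke_local_subbase(2)[OF H U] unfolding Hecke_nbhd_def by blast
    \<comment> \<open>The bound for \<pi>(g) at x uses the conjugates of \<open>H\<close> by x and
      by \<pi>(x), hence both \<open>F\<close> and its image.\<close>
    define F' where "F' = F \<union> \<pi> ` F"
    have F': "finite F'" "F' \<subseteq> carrier G" using F by (auto simp: F'_def)
    have "\<pi> g \<in> Hecke_nbhd G H F" if g: "g \<in> Hecke_nbhd G H F'" for g
      unfolding mem_Hecke_nbhd_iff[OF H F(2)]
    proof (intro conjI ballI)
      have gc: "g \<in> carrier G" and gH: "\<And>x. x \<in> F' \<Longrightarrow> inv x \<otimes> g \<otimes> x \<in> H"
        using g by (auto simp: mem_Hecke_nbhd_iff[OF H F'(2)])
      then show "\<pi> g \<in> carrier G" by simp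
      fix x assume x: "x \<in> F"
      then have xc: "x \<in> carrier G" using F by blast
      then obtain n q where nq: "n \<in> N" "q \<in> Q" "x = n \<otimes> q" unfolding NQ[symmetric] set_mult_def by blast
      have c: "n \<in> carrier G" "q \<in> carrier G" using nq N_c Q_c by auto
      \<comment> \<open>With the factors swapped to x = q n', conjugation by x^-1 is conjugation by
        q^-1 followed by conjugation by n'^-1, an element of \<open>N\<close>.\<close>
      define n' where "n' = inv q \<otimes> n \<otimes> q"
      have n': "n' \<in> N" using normal.inv_op_closed1[OF N c(2) nq(1)] by (simp add: n'_def)
      then have n'c: "n' \<in> carrier G" using N_c by auto
      have x_eq: "x = q \<otimes> n'" using c by (simp add: n'_def nq(3) m_assoc[symmetric])
      have \<pi>q: "\<pi> q = q" using \<pi>_eq[of \<one> q] nq(2) c subgroup.one_closed[OF NG] by simp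
      have conj: "inv x \<otimes> y \<otimes> x = inv n' \<otimes> (inv q \<otimes> y \<otimes> q) \<otimes> n'" if "y \<in> carrier G" for y
        using that c n'c by (simp add: x_eq inv_mult_group m_assoc)
      have "\<pi> x = q" using nq \<pi>_eq by simp
      then have "x \<in> F'" "q \<in> F'" using x by (auto simp: F'_def)
      then have "inv q \<otimes> g \<otimes> q \<in> H" "inv n' \<otimes> (inv q \<otimes> g \<otimes> q) \<otimes> n' \<in> H"
        using gH[of q] gH[of x] conj[OF gc] by auto
      \<comment> \<open>Here h is q^-1 g q, and \<pi>(h) = q^-1 \<pi>(g) q because
        \<open>\<pi>\<close> fixes q.\<close>
      from H_conj[OF n' this] show "inv x \<otimes> \<pi> g \<otimes> x \<in> H"
        using c gc by (simp add: conj \<pi>q)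
    qed
    moreover have "\<one> <# Hecke_nbhd G H F' = Hecke_nbhd G H F'"
      by (auto simp: l_coset_def Hecke_nbhd_def)
    ultimately show "\<exists>V. openin (Hecke_topology G H) V \<and> \<one> \<in> V \<and> \<pi> ` V \<subseteq> U"
      using openin_Hecke_coset[OF H F' one_closed] mem_Hecke_coset[OF H F'(2) one_closed] F(3)
      by (intro exI[of _ "Hecke_nbhd G H F'"]) auto
  qed
qed

end

section \<open>Splitting of the completion and of the closure of \<open>H\<close>\<close>

theorem corollary2p8:
  fixes G :: "('a, 'c) monoid_scheme"
    and K :: "('b, 'd) monoid_scheme"
    and TK :: "'b topology"
    and \<iota> :: "'a \<Rightarrow> 'b"
    and N Q M R H :: "'a set"
    and Hbar :: "'b set"
  assumes "group G"
    and "internal_semidirect G N Q"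
    and "M \<lhd> G\<lparr>carrier := N\<rparr>"
    and "subgroup R (G\<lparr>carrier := Q\<rparr>)"
    and "\<forall>r\<in>R. conj_set G r M = M"
    and "subgroup H G"
    and "internal_semidirect (G\<lparr>carrier := H\<rparr>) M R"
    and "reduced_Hecke_pair G H"
    and "Schlichting_completion G H K TK Hbar \<iota>"
  shows "topological_semidirect K TK (TK closure_of (\<iota> ` N)) (TK closure_of (\<iota> ` Q)) \<and>
         topological_semidirect (K\<lparr>carrier := Hbar\<rparr>) (subtopology TK Hbar)
           (TK closure_of (\<iota> ` M)) (TK closure_of (\<iota> ` R))"
proof -
  interpret group G by fact
  have N: "subgroup N G" and Q: "subgroup Q G" and NQ: "N <#>\<^bsub>G\<^esub> Q = carrier G"
    using assms(2) by (auto simp: internal_semidirect_def normal_imp_subgroup)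
  have M_N: "M \<subseteq> N" using subgroup.subset[OF normal_imp_subgroup[OF assms(3)]] by simp
  have R_Q: "R \<subseteq> Q" using subgroup.subset[OF assms(4)] by simp
  have M: "subgroup M (G\<lparr>carrier := H\<rparr>)" and R: "subgroup R (G\<lparr>carrier := H\<rparr>)"
    and MR: "H = M <#>\<^bsub>G\<^esub> R"
    using assms(7) by (auto simp: internal_semidirect_def normal_imp_subgroup set_mult_def)
  have comp: "group_completion G (Hecke_topology G H) K TK \<iota>" and Hbar: "Hbar = TK closure_of (\<iota> ` H)"
    using assms(9) by (auto simp: Schlichting_completion_def)
  interpret K: topological_group K TK using comp by (simp add: group_completion_def)
  have \<iota>: "\<iota> \<in> hom G K" "inj_on \<iota> (carrier G)" and dense: "TK closure_of (\<iota> ` carrier G) = carrier K"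
    and haus: "Hausdorff_space TK" and complete: "two_sided_complete K TK"
    using comp by (auto simp: group_completion_def)
  interpret \<iota>: group_hom G K \<iota> by unfold_locales (rule \<iota>)
  obtain \<pi> where \<pi>: "\<pi> \<in> hom G G" and \<pi>_eq: "\<And>n q. n \<in> N \<Longrightarrow> q \<in> Q \<Longrightarrow> \<pi> (n \<otimes>\<^bsub>G\<^esub> q) = q"
    using internal_semidirect_projection[OF assms(2)] by blast
  have "continuous_map (Hecke_topology G H) (Hecke_topology G H) \<pi>"
    using subgroup.subset[OF M]
    by (intro continuous_map_Hecke_projection[OF assms(2) \<pi> \<pi>_eq assms(3) R_Q assms(6) _ MR]) auto
  then have "continuous_map (Hecke_topology G H) TK (\<iota> \<circ> \<pi>)"
    by (rule continuous_map_compose[OF _ continuous_map_group_completion[OF comp]])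
  \<comment> \<open>The projection followed by \<open>\<iota>\<close> is extended with
    \<open>K\<close> itself as target, so \<open>p\<close> is an endomorphism of \<open>K\<close>
    that restricts to \<open>\<pi>\<close> on \<open>G\<close>.\<close>
  then obtain p where p: "p \<in> hom K K" "continuous_map TK TK p"
    and p\<iota>: "\<And>x. x \<in> carrier G \<Longrightarrow> p (\<iota> x) = \<iota> (\<pi> x)"
    using group_completion_extend_hom[OF comp K.topological_group_axioms haus complete
        Group.hom_compose[OF \<pi> \<iota>(1)]] by auto
  \<comment> \<open>This form covers both claims: (A, L, S) is (G, N, Q) for the first and (H, M, R)
    for the second.\<close>
  have split: "topological_semidirect (K\<lparr>carrier := TK closure_of (\<iota> ` A)\<rparr>)
      (subtopology TK (TK closure_of (\<iota> ` A))) (TK closure_of (\<iota> ` L)) (TK closure_of (\<iota> ` S))"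
    if A: "subgroup A G" "A = L <#>\<^bsub>G\<^esub> S" and L: "L \<subseteq> N" "\<one>\<^bsub>G\<^esub> \<in> L" and S: "S \<subseteq> Q" "\<one>\<^bsub>G\<^esub> \<in> S"
    for A L S
  proof -
    have c: "L \<subseteq> carrier G" "S \<subseteq> carrier G"
      using L(1) S(1) subgroup.subset[OF N] subgroup.subset[OF Q] by auto
    have \<pi>_LS: "\<pi> (l \<otimes>\<^bsub>G\<^esub> s) = s" if "l \<in> L" "s \<in> S" for l s using that L S \<pi>_eq by blast
    have \<pi>_L: "\<pi> l = \<one>\<^bsub>G\<^esub>" if "l \<in> L" for l using \<pi>_LS[of l "\<one>\<^bsub>G\<^esub>"] that S(2) c by auto
    have \<pi>_S: "\<pi> s = s" if "s \<in> S" for s using \<pi>_LS[of "\<one>\<^bsub>G\<^esub>" s] that L(2) c by auto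
    have LA: "L \<subseteq> A" and SA: "S \<subseteq> A"
      unfolding A(2) set_mult_def using L(2) S(2) c by force+
    have p_A: "p ` \<iota> ` A = \<iota> ` S"
    proof
      show "p ` \<iota> ` A \<subseteq> \<iota> ` S"
      proof clarify
        fix a assume a: "a \<in> A"
        then obtain l s where ls: "l \<in> L" "s \<in> S" "a = l \<otimes>\<^bsub>G\<^esub> s" unfolding A(2) set_mult_def by blast
        then have "p (\<iota> a) = \<iota> s" using p\<iota>[of a] \<pi>_LS subgroup.mem_carrier[OF A(1) a] by simp
        then show "p (\<iota> a) \<in> \<iota> ` S" using ls by blast
      qed
      show "\<iota> ` S \<subseteq> p ` \<iota> ` A"
      proof clarify
        fix s assume "s \<in> S"
        then have "\<iota> s = p (\<iota> s)" using p\<iota>[of s] \<pi>_S c by auto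
        then show "\<iota> s \<in> p ` \<iota> ` A" using SA \<open>s \<in> S\<close> by blast
      qed
    qed
    \<comment> \<open>For a = l s the value p(\<iota>(a)) is \<iota>(s), so injectivity of
      \<open>\<iota>\<close> forces s to be one when a is in the kernel.\<close>
    have ker: "\<iota> ` A \<inter> kernel K K p = \<iota> ` L"
    proof
      show "\<iota> ` A \<inter> kernel K K p \<subseteq> \<iota> ` L"
      proof
        fix y assume "y \<in> \<iota> ` A \<inter> kernel K K p"
        then obtain a where a: "a \<in> A" "y = \<iota> a" "p (\<iota> a) = \<one>\<^bsub>K\<^esub>" by (auto simp: kernel_def)
        then obtain l s where ls: "l \<in> L" "s \<in> S" "a = l \<otimes>\<^bsub>G\<^esub> s" unfolding A(2) set_mult_def by blast
        then have "\<iota> s = \<iota> \<one>\<^bsub>G\<^esub>" using a(3) p\<iota>[of a] \<pi>_LS subgroup.mem_carrier[OF A(1) a(1)] by simp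
        then have "s = \<one>\<^bsub>G\<^esub>" using ls c inj_onD[OF \<iota>(2)] by blast
        then show "y \<in> \<iota> ` L" using ls a(2) c by auto
      qed
      show "\<iota> ` L \<subseteq> \<iota> ` A \<inter> kernel K K p"
        using LA c p\<iota> \<pi>_L by (auto simp: kernel_def)
    qed
    have "topological_semidirect (K\<lparr>carrier := TK closure_of (\<iota> ` A)\<rparr>)
        (subtopology TK (TK closure_of (\<iota> ` A)))
        (TK closure_of (\<iota> ` A \<inter> kernel K K p)) (TK closure_of (p ` \<iota> ` A))"
    proof (rule K.topological_semidirect_closure_of[OF haus p \<iota>.subgroup_img_is_subgroup[OF A(1)]])
      show "p ` \<iota> ` A \<subseteq> \<iota> ` A" unfolding p_A using SA by blast
      fix y assume "y \<in> \<iota> ` A"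
      then have "p y \<in> \<iota> ` S" using p_A by blast
      then show "p (p y) = p y" using p\<iota> \<pi>_S c by auto
    qed
    then show ?thesis unfolding p_A ker .
  qed
  \<comment> \<open>For A = G the closure is all of \<open>K\<close> by density, so restricting the
    group and its topology to it changes nothing.\<close>
  have "subtopology TK (carrier K) = TK" by (metis K.topspace_eq subtopology_topspace)
  then have "topological_semidirect K TK (TK closure_of (\<iota> ` N)) (TK closure_of (\<iota> ` Q))"
    using split[OF subgroup_self NQ[symmetric]] N Q
    by (simp add: dense subgroup.one_closed)
  moreover have "topological_semidirect (K\<lparr>carrier := Hbar\<rparr>) (subtopology TK Hbar)
      (TK closure_of (\<iota> ` M)) (TK closure_of (\<iota> ` R))"
    unfolding Hbar using split[OF assms(6) MR M_N _ R_Q] subgroup.one_closed[OF M] subgroup.one_closed[OF R]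
    by simp
  ultimately show ?thesis by blast
qed

end
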